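(* Let $\Theta\subset\mathbb{R}^p$ and, for each $n$, let $Q_n:\Theta\to\mathbb{R}$ be a (random) objective function depending on data $\mathbf z_1,\dots,\mathbf z_n$ and $\tilde Q_n:\Theta\to\mathbb{R}$ a (random) approximation of it. Let $\hat{\boldsymbol\theta}_{AM}=\arg\max_{\boldsymbol\theta\in\Theta}\tilde Q_n(\boldsymbol\theta)$. Assume: (i) there exist a function $Q_0:\Theta\to\mathbb{R}$ and $\boldsymbol\theta_0\in\Theta$ such that $Q_0$ is uniquely maximized at $\boldsymbol\theta_0$, $\Theta$ is compact, $Q_0$ is continuous, and $\sup_{\boldsymbol\theta\in\Theta}|Q_n(\boldsymbol\theta)-Q_0(\boldsymbol\theta)|\to0$ in probability; moreover $\boldsymbol\theta_0$ lies in the interior of $\Theta$; $Q_n$ is twice continuously differentiable in a neighborhood $\mathcal N$ of $\boldsymbol\theta_0$; $\sqrt n\,\nabla_{\boldsymbol\theta}Q_n(\boldsymbol\theta_0)\xrightarrow{d}N(0,\Sigma)$; there is a matrix-valued function $H(\boldsymbol\theta)$, continuous at $\boldsymbol\theta_0$, with $\sup_{\boldsymbol\theta\in\mathcal N}\|\nabla_{\boldsymbol\theta\boldsymbol\theta}Q_n(\boldsymbol\theta)-H(\boldsymbol\theta)\|\to0$ in probability; and $H=H(\boldsymbol\theta_0)$ is nonsingular; (ii) with probability one, $\tilde Q_n$ is twice continuously differentiable in the neighborhood $\mathcal N$ of $\boldsymbol\theta_0$; (iii) $\operatorname{plim}_{n\to\infty}\sup_{\boldsymbol\theta\in\Theta}|\tilde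 Q_n(\boldsymbol\theta)-Q_n(\boldsymbol\theta)|=0$; (iv) $\operatorname{plim}_{n\to\infty}\sqrt n\,\sup_{\boldsymbol\theta\in\Theta}\|\nabla_{\boldsymbol\theta}\tilde Q_n(\boldsymbol\theta)-\nabla_{\boldsymbol\theta}Q_n(\boldsymbol\theta)\|=0$; (v) $\operatorname{plim}_{n\to\infty}\sup_{\boldsymbol\theta\in\Theta}\|\nabla_{\boldsymbol\theta\boldsymbol\theta}\tilde Q_n(\boldsymbol\theta)-\nabla_{\boldsymbol\theta\boldsymbol\theta}Q_n(\boldsymbol\theta)\|=0$. Then $\sqrt n(\hat{\boldsymbol\theta}_{AM}-\boldsymbol\theta_0)\xrightarrow{d}N(\mathbf 0,H^{-1}\Sigma H^{-1})$ as $n\to\infty$.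
   Context: $\nabla_{\boldsymbol\theta}$ and $\nabla_{\boldsymbol\theta\boldsymbol\theta}$ denote gradient and Hessian with respect to $\boldsymbol\theta$; $\operatorname{plim}$ is the limit in probability and $\xrightarrow{d}$ convergence in distribution. *)

theory Defs
  imports "HOL-Probability.Probability"
begin

definition grad :: "(real^'p \<Rightarrow> real) \<Rightarrow> real^'p \<Rightarrow> real^'p" where
  "grad f x = (\<chi> i. frechet_derivative f (at x) (axis i 1))"

definition hess :: "(real^'p \<Rightarrow> real) \<Rightarrow> real^'p \<Rightarrow> real^'p^'p" where
  "hess f x = (\<chi> i j. frechet_derivative (grad f) (at x) (axis j 1) $ i)"

definition C2_on :: "(real^'p \<Rightarrow> real) \<Rightarrow> (real^'p) set \<Rightarrow> bool" where
  "C2_on f S \<longleftrightarrow> (\<forall>x\<in>S. f differentiable (at x) \<and> grad f differentiable (at x))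
                   \<and> continuous_on S (hess f)"

definition unif_plim0 :: "'a measure \<Rightarrow> (nat \<Rightarrow> 'a \<Rightarrow> 'b \<Rightarrow> real) \<Rightarrow> 'b set \<Rightarrow> bool" where
  "unif_plim0 M D S \<longleftrightarrow>
     (\<forall>n e. {\<omega>\<in>space M. \<exists>\<theta>\<in>S. D n \<omega> \<theta> > e} \<in> sets M) \<and>
     (\<forall>e>0. (\<lambda>n. measure M {\<omega>\<in>space M. \<exists>\<theta>\<in>S. D n \<omega> \<theta> > e}) \<longlonglongrightarrow> 0)"

definition conv_distr :: "'a measure \<Rightarrow> (nat \<Rightarrow> 'a \<Rightarrow> 'b::euclidean_space) \<Rightarrow> 'b measure \<Rightarrow> bool" where
  "conv_distr M X \<mu> \<longleftrightarrow> (\<forall>n. X n \<in> borel_measurable M) \<and>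
     (\<forall>f::'b \<Rightarrow> real. continuous_on UNIV f \<and> bounded (range f) \<longrightarrow>
        (\<lambda>n. integral\<^sup>L M (\<lambda>\<omega>. f (X n \<omega>))) \<longlonglongrightarrow> integral\<^sup>L \<mu> f)"

definition std_gauss :: "(real^'p) measure" where
  "std_gauss = density lborel
     (\<lambda>x. ennreal ((2 * pi) powr (- real CARD('p) / 2) * exp (- (norm x)\<^sup>2 / 2)))"

definition mvn0 :: "real^'p^'p \<Rightarrow> (real^'p) measure" where
  "mvn0 S = distr std_gauss borel (\<lambda>z. (SOME A :: real^'p^'p. A ** transpose A = S) *v z)"

end

theory Submission
  imports Defs
begin

text \<open>
  Write \<open>S\<^sub>n = sqrt n \<nabla>Q\<^sub>n(\<theta>\<^sub>0)\<close> and let \<open>\<theta>\<close> be the maximizer of the approximate objective. Uniform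
  convergence and the unique maximum of \<open>Q\<^sub>0\<close> force \<open>\<theta>\<close> close to \<open>\<theta>\<^sub>0\<close>, hence into the interior of
  \<open>\<Theta>\<close>, where the approximate gradient vanishes and therefore \<open>sqrt n \<nabla>Q\<^sub>n(\<theta>) = o\<^sub>p(1)\<close>. The mean value
  inequality gives \<open>\<nabla>Q\<^sub>n(\<theta>) = \<nabla>Q\<^sub>n(\<theta>\<^sub>0) + H (\<theta> - \<theta>\<^sub>0) + o\<^sub>p(norm (\<theta> - \<theta>\<^sub>0))\<close>; since \<open>S\<^sub>n\<close> is tight, this
  becomes \<open>sqrt n (\<theta> - \<theta>\<^sub>0) = - H\<^sup>-\<^sup>1 S\<^sub>n + o\<^sub>p(1)\<close>, and Slutsky's lemma applies.

  The limit law is the image of \<open>N(0, \<Sigma>)\<close> under \<open>- H\<^sup>-\<^sup>1\<close>, where \<open>H\<close> is symmetric as a limit of Hessians.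
  That the law of \<open>A z\<close> for a standard Gaussian \<open>z\<close> depends only on \<open>A A\<^sup>T\<close> follows from rotation
  invariance, because \<open>norm (A\<^sup>T x) = norm (B\<^sup>T x)\<close> for all \<open>x\<close> yields an orthogonal map taking \<open>A\<^sup>T\<close> to \<open>B\<^sup>T\<close>.
\<close>

subsection \<open>Centered Gaussian laws\<close>

text \<open>Equal norms make sending \<open>f x\<close> to \<open>g x\<close> a well-defined linear
  isometry of \<open>range f\<close> onto \<open>range g\<close>. The ranges then have the same
  dimension, hence so do their orthogonal complements, and an isometry between the complements
  completes the map on the whole space.\<close>

lemma orthogonal_transformation_extending:
  fixes f g :: "'a::euclidean_space \<Rightarrow> 'b::euclidean_space"
  assumes f: "linear f" and g: "linear g" and eq: "\<And>x. norm (f x) = norm (g x)"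
  obtains T where "orthogonal_transformation T" "\<And>x. T (f x) = g x"
proof -
  interpret f: linear f by fact
  interpret g: linear g by fact
  obtain k where k: "linear k" "\<And>v. v \<in> range f \<Longrightarrow> f (k v) = v"
    using linear_exists_right_inverse_on[OF f subspace_UNIV] by auto
  define h where "h = g \<circ> k"
  have h: "linear h" unfolding h_def using k(1) g by (rule linear_compose)
  interpret h: linear h by fact
  have hnorm: "norm (h v) = norm v" if "v \<in> range f" for v
    using eq[of "k v"] k(2)[OF that] by (simp add: h_def)
  have hf: "h (f x) = g x" for x
  proof -
    have "norm (g (k (f x) - x)) = norm (f (k (f x) - x))" by (simp add: eq)
    also have "\<dots> = 0" by (simp add: f.diff k(2))
    finally show ?thesis by (simp add: g.diff h_def)
  qed
  define S where "S = range f"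
  define T where "T = range g"
  have subS: "subspace S" and subT: "subspace T"
    unfolding S_def T_def using f g subspace_UNIV linear_subspace_image by blast+
  have spS: "span S = S" using subS by simp
  have "inj_on h S"
    by (rule inj_onI) (metis S_def h.diff hnorm norm_eq_zero right_minus_eq subS subspace_diff)
  then have "dim (h ` S) = dim S" using dim_image_eq[OF h, of S] spS by simp
  moreover have "h ` S = T" unfolding S_def T_def by (auto simp: hf image_image)
  ultimately have dimST: "dim T = dim S" by simp
  define S' where "S' = {y. \<forall>x\<in>S. orthogonal x y}"
  define T' where "T' = {y. \<forall>x\<in>T. orthogonal x y}"
  have sub': "subspace S'" "subspace T'"
    unfolding S'_def T'_def by (simp_all add: subspace_orthogonal_to_vectors)
  have "dim S' + dim S = DIM('b)" "dim T' + dim T = DIM('b)"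
    using dim_subspace_orthogonal_to_vectors[OF subS subspace_UNIV]
      dim_subspace_orthogonal_to_vectors[OF subT subspace_UNIV]
    by (simp_all add: S'_def T'_def)
  with dimST have "dim S' \<le> dim T'" by simp
  then obtain m where m: "linear m" "m \<in> S' \<rightarrow> T'" "\<And>x. x \<in> S' \<Longrightarrow> norm (m x) = norm x"
    using isometry_subset_subspace[OF sub'] by blast
  interpret m: linear m by fact
  have "\<exists>y. y \<in> S \<and> x - y \<in> S'" for x
  proof -
    obtain y z where "y \<in> span S" "\<And>w. w \<in> span S \<Longrightarrow> orthogonal z w" "x = y + z"
      using orthogonal_subspace_decomp_exists[of S x] by metis
    then show ?thesis unfolding spS S'_def
      by (intro exI[of _ y]) (auto simp: orthogonal_commute)
  qed
  then obtain p where p: "\<And>x. p x \<in> S" "\<And>x. x - p x \<in> S'" by metis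
  define U where "U x = h (p x) + m (x - p x)" for x
  have dec: "norm (h a + m b) = norm (a + b)" if a: "a \<in> S" and b: "b \<in> S'" for a b
  proof -
    have "orthogonal a b" using a b by (auto simp: S'_def)
    moreover have "orthogonal (h a) (m b)"
      using a b m(2) \<open>h ` S = T\<close> by (auto simp: T'_def)
    ultimately have "(norm (h a + m b))\<^sup>2 = (norm (a + b))\<^sup>2"
      using a b by (simp add: norm_add_Pythagorean hnorm[folded S_def] m(3))
    then show ?thesis by simp
  qed
  have pf: "p (f x) = f x" for x
  proof -
    have "f x - p (f x) \<in> S" using p(1) subS by (intro subspace_diff) (auto simp: S_def)
    then have "orthogonal (f x - p (f x)) (f x - p (f x))"
      using p(2)[of "f x"] by (auto simp: S'_def)
    then show ?thesis by (simp add: orthogonal_def)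
  qed
  have Uf: "U (f x) = g x" for x by (simp add: U_def pf hf m.zero)
  \<comment> \<open>Although \<open>p\<close> is only chosen pointwise, differences of its values
    stay in \<open>S\<close> and differences of the remainders in \<open>S'\<close>, so
    \<open>dec\<close> applies to them. Preserving distances and fixing 0 then makes
    \<open>U\<close> linear.\<close>
  have "dist (U x) (U y) = dist x y" for x y
  proof -
    have "U x - U y = h (p x - p y) + m ((x - p x) - (y - p y))"
      by (simp add: U_def h.diff m.diff)
    then have "norm (U x - U y) = norm ((p x - p y) + ((x - p x) - (y - p y)))"
      using dec[of "p x - p y" "(x - p x) - (y - p y)"] p subS sub'(1)
      by (simp add: subspace_diff)
    then show ?thesis by (simp add: dist_norm)
  qed
  moreover have "U 0 = 0" using Uf[of 0] by (simp add: f.zero g.zero)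
  ultimately have "orthogonal_transformation U"
    by (simp add: orthogonal_transformation_isometry)
  with Uf that show thesis by blast
qed

section \<open>Rotation invariance of Lebesgue measure\<close>

text \<open>The classical Fubini argument for the uniqueness of Haar measure.\<close>
lemma nn_integral_mult_translation_invariant:
  fixes \<mu> :: "'a::euclidean_space measure" and f g :: "'a \<Rightarrow> ennreal"
  assumes \<mu>: "sigma_finite_measure \<mu>" and sets: "sets \<mu> = sets borel"
    and inv: "\<And>c. distr \<mu> borel ((+) c) = \<mu>"
    and f[measurable]: "f \<in> borel_measurable borel" and g[measurable]: "g \<in> borel_measurable borel"
  shows "(\<integral>\<^sup>+x. f x \<partial>\<mu>) * (\<integral>\<^sup>+y. g y \<partial>lborel) = (\<integral>\<^sup>+x. g x \<partial>\<mu>) * (\<integral>\<^sup>+y. f (- y) \<partial>lborel)"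
proof -
  note [measurable_cong] = sets
  interpret P: pair_sigma_finite \<mu> lborel
    using \<mu> sigma_finite_lborel by (simp add: pair_sigma_finite_def)
  have shift_\<mu>: "(\<integral>\<^sup>+x. u x \<partial>\<mu>) = (\<integral>\<^sup>+x. u (c + x) \<partial>\<mu>)"
    if [measurable]: "u \<in> borel_measurable borel" for u :: "'a \<Rightarrow> ennreal" and c
    by (subst inv[of c, symmetric], subst nn_integral_distr) auto
  have shift_l: "(\<integral>\<^sup>+x. u x \<partial>lborel) = (\<integral>\<^sup>+x. u (c + x) \<partial>lborel)"
    if [measurable]: "u \<in> borel_measurable borel" for u :: "'a \<Rightarrow> ennreal" and c
    by (subst lborel_distr_plus[of c, symmetric], subst nn_integral_distr) auto
  have "(\<integral>\<^sup>+x. f x \<partial>\<mu>) * (\<integral>\<^sup>+y. g y \<partial>lborel) = (\<integral>\<^sup>+x. \<integral>\<^sup>+y. f x * g y \<partial>lborel \<partial>\<mu>)"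
    by (simp add: nn_integral_cmult, subst nn_integral_multc) auto
  \<comment> \<open>The inner shift couples the variables: once the integrals are exchanged,
    translating \<open>x\<close> by \<open>- y\<close> moves the shift from \<open>g\<close> to
    \<open>f\<close>, and a last translation of \<open>y\<close> by \<open>x\<close> decouples the
    two factors, leaving \<open>f\<close> reflected.\<close>
  also have "\<dots> = (\<integral>\<^sup>+x. \<integral>\<^sup>+y. f x * g (x + y) \<partial>lborel \<partial>\<mu>)"
    by (rule nn_integral_cong, rule shift_l) measurable
  also have "\<dots> = (\<integral>\<^sup>+y. \<integral>\<^sup>+x. f x * g (x + y) \<partial>\<mu> \<partial>lborel)"
    by (rule P.Fubini'[symmetric]) measurable
  also have "\<dots> = (\<integral>\<^sup>+y. \<integral>\<^sup>+x. f (- y + x) * g x \<partial>\<mu> \<partial>lborel)"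
  proof (rule nn_integral_cong)
    fix y :: 'a
    show "(\<integral>\<^sup>+x. f x * g (x + y) \<partial>\<mu>) = (\<integral>\<^sup>+x. f (- y + x) * g x \<partial>\<mu>)"
      by (subst shift_\<mu>[of _ "- y"]) (simp_all add: algebra_simps)
  qed
  also have "\<dots> = (\<integral>\<^sup>+x. \<integral>\<^sup>+y. f (- y + x) * g x \<partial>lborel \<partial>\<mu>)"
    by (rule P.Fubini') measurable
  also have "\<dots> = (\<integral>\<^sup>+x. \<integral>\<^sup>+y. f (- y) * g x \<partial>lborel \<partial>\<mu>)"
  proof (rule nn_integral_cong)
    fix x :: 'a
    show "(\<integral>\<^sup>+y. f (- y + x) * g x \<partial>lborel) = (\<integral>\<^sup>+y. f (- y) * g x \<partial>lborel)"
      by (subst shift_l[of _ x]) (simp_all add: algebra_simps)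
  qed
  also have "\<dots> = (\<integral>\<^sup>+x. g x \<partial>\<mu>) * (\<integral>\<^sup>+y. f (- y) \<partial>lborel)"
    by (subst nn_integral_multc, simp, subst nn_integral_cmult) (auto simp: mult.commute)
  finally show ?thesis .
qed

lemma borel_measurable_linear:
  fixes f :: "'a::euclidean_space \<Rightarrow> 'b::real_normed_vector"
  shows "linear f \<Longrightarrow> f \<in> borel_measurable borel"
  by (simp add: borel_measurable_continuous_onI linear_continuous_on linear_conv_bounded_linear)

text \<open>The library's \<open>measure_orthogonal_image\<close> covers only \<open>real^'n\<close> with a well-ordered index type.\<close>
lemma lborel_distr_orthogonal:
  fixes T :: "'a::euclidean_space \<Rightarrow> 'a"
  assumes T: "orthogonal_transformation T"
  shows "distr lborel borel T = lborel"
proof -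
  have lin: "linear T" using T by (rule orthogonal_transformation_linear)
  interpret linear T by fact
  have [measurable]: "T \<in> borel_measurable borel"
    using lin by (rule borel_measurable_linear)
  define \<mu> where "\<mu> = distr lborel borel T"
  have sets[measurable_cong]: "sets \<mu> = sets borel" by (simp add: \<mu>_def)
  have emT: "emeasure \<mu> (ball 0 r) = emeasure lborel (ball (0::'a) r)" for r
  proof -
    have "T -` ball 0 r = ball 0 r"
      using T by (auto simp: orthogonal_transformation_norm)
    then show ?thesis by (simp add: \<mu>_def emeasure_distr)
  qed
  have sf: "sigma_finite_measure \<mu>"
  proof
    let ?A = "range (\<lambda>n. ball (0::'a) (real n))"
    have "\<Union>?A = space \<mu>"
      by (auto simp: \<mu>_def) (meson reals_Archimedean2)
    moreover have "\<forall>a\<in>?A. emeasure \<mu> a \<noteq> \<infinity>"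
      using emeasure_lborel_ball_finite by (auto simp: emT less_top)
    ultimately show "\<exists>A. countable A \<and> A \<subseteq> sets \<mu> \<and> \<Union> A = space \<mu> \<and> (\<forall>a\<in>A. emeasure \<mu> a \<noteq> \<infinity>)"
      by (intro exI[of _ ?A]) (auto simp: sets)
  qed
  \<comment> \<open>Since \<open>T\<close> is linear and onto, translation by \<open>c = T d\<close>
    after \<open>T\<close> is \<open>T\<close> after translation by \<open>d\<close>.\<close>
  have inv: "distr \<mu> borel ((+) c) = \<mu>" for c
  proof -
    obtain d where d: "c = T d"
      using orthogonal_transformation_surj[OF T] by blast
    have "distr \<mu> borel ((+) c) = distr (distr lborel borel ((+) d)) borel T"
      unfolding \<mu>_def by (simp add: distr_distr o_def d add)
    then show ?thesis by (simp add: lborel_distr_plus \<mu>_def)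
  qed
  \<comment> \<open>With the indicator of the unit ball as second function, whose volume
    \<open>v\<close> is finite and nonzero, the measure of \<open>A\<close> becomes an expression
    free of \<open>\<nu>\<close>. Using it for both \<open>\<mu>\<close> and \<open>lborel\<close>
    identifies them, the reflection being the same on both sides.\<close>
  have eq: "emeasure \<nu> A = (\<integral>\<^sup>+y. indicator A (- y) \<partial>lborel)"
    if \<nu>: "sigma_finite_measure \<nu>" "sets \<nu> = sets borel" "\<And>c. distr \<nu> borel ((+) c) = \<nu>"
      "emeasure \<nu> (ball 0 1) = emeasure lborel (ball (0::'a) 1)"
      and A: "A \<in> sets borel" for \<nu> :: "'a measure" and A
  proof -
    define v where "v = emeasure lborel (ball (0::'a) 1)"
    have "v < \<infinity>" unfolding v_def using emeasure_lborel_ball_finite by (simp add: less_top)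
    moreover have "v \<noteq> 0"
      unfolding v_def using content_ball_pos[of 1 "0::'a"] by (auto simp: measure_def)
    moreover have "emeasure \<nu> A * v = v * (\<integral>\<^sup>+y. indicator A (- y) \<partial>lborel)"
      using nn_integral_mult_translation_invariant[OF \<nu>(1-3), of "indicator A" "indicator (ball 0 1)"] A \<nu>(2,4)
      by (simp add: v_def borel_measurable_indicator)
    ultimately show ?thesis
      by (auto simp: mult.commute[of _ v] ennreal_mult_cancel_left)
  qed
  have "\<mu> = lborel"
  proof (rule measure_eqI)
    fix A assume "A \<in> sets \<mu>"
    then have A: "A \<in> sets borel" by (simp add: sets)
    show "emeasure \<mu> A = emeasure lborel A"
      using eq[OF sf sets inv emT A] eq[OF sigma_finite_lborel sets_lborel lborel_distr_plus refl A]
      by simp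
  qed (simp add: sets)
  then show ?thesis by (simp add: \<mu>_def)
qed

section \<open>The standard Gaussian and its linear images\<close>

lemma sets_std_gauss [simp, measurable_cong]: "sets std_gauss = sets borel"
  by (simp add: std_gauss_def)

text \<open>The density depends on \<open>x\<close> through \<open>norm x\<close> only, and
  orthogonal maps preserve both the norm and Lebesgue measure.\<close>

lemma std_gauss_distr_orthogonal:
  fixes T :: "real^'p \<Rightarrow> real^'p"
  assumes T: "orthogonal_transformation T"
  shows "distr std_gauss borel T = std_gauss"
proof -
  have [measurable]: "T \<in> borel_measurable borel"
    using orthogonal_transformation_linear[OF T] by (rule borel_measurable_linear)
  define g where "g x = ennreal ((2 * pi) powr (- real CARD('p) / 2) * exp (- (norm x)\<^sup>2 / 2))" for x :: "real^'p"
  have [measurable]: "g \<in> borel_measurable borel" unfolding g_def by measurable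
  have "g (T x) = g x" for x by (simp add: g_def orthogonal_transformation_norm[OF T])
  then have "density lborel g = density lborel (\<lambda>x. g (T x))" by simp
  then have "distr (density lborel g) borel T = density (distr lborel borel T) g"
    by (simp add: density_distr)
  then show ?thesis
    unfolding std_gauss_def g_def [symmetric] by (simp add: lborel_distr_orthogonal[OF T])
qed

lemma borel_measurable_matrix_vector [measurable]:
  "(\<lambda>z. (B :: real^'n^'m) *v z) \<in> borel_measurable borel"
  by (simp add: borel_measurable_linear)

lemma inner_matrix_vector_transpose:
  fixes A :: "real^'n^'m"
  shows "x \<bullet> (A *v y) = (transpose A *v x) \<bullet> y"
  by (metis dot_lmul_matrix vector_transpose_matrix transpose_transpose)

text \<open>This makes the choice of root inside \<open>mvn0\<close> immaterial. The common product
  determines the norms of \<open>transpose B *v x\<close> and \<open>transpose C *v x\<close>, so an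
  orthogonal \<open>T\<close> carries one to the other, and \<open>C\<close> is \<open>B\<close>
  composed with a rotation that the Gaussian does not see.\<close>

lemma std_gauss_distr_matrix_cong:
  fixes B C :: "real^'p^'p"
  assumes eq: "B ** transpose B = C ** transpose C"
  shows "distr std_gauss borel ((*v) B) = distr std_gauss borel ((*v) C)"
proof -
  have sq: "(norm (transpose D *v x))\<^sup>2 = x \<bullet> ((D ** transpose D) *v x)" for D :: "real^'p^'p" and x
    by (simp add: power2_norm_eq_inner matrix_vector_mul_assoc[symmetric] inner_matrix_vector_transpose)
  have "norm (transpose B *v x) = norm (transpose C *v x)" for x
    using sq[of B x] sq[of C x] eq by (metis norm_ge_zero power2_eq_iff_nonneg)
  then obtain T where T: "orthogonal_transformation T" "\<And>x. T (transpose B *v x) = transpose C *v x"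
    using orthogonal_transformation_extending[of "(*v) (transpose B)" "(*v) (transpose C)"] by auto
  define U where "U = inv T"
  have U: "orthogonal_transformation U"
    unfolding U_def using T(1) by (rule orthogonal_transformation_inv)
  have TU: "T (U z) = z" for z
    unfolding U_def using orthogonal_transformation_surj[OF T(1)] by (rule surj_f_inv_f)
  \<comment> \<open>This is the transpose of the relation between \<open>transpose B\<close> and
    \<open>transpose C\<close>, since the adjoint of \<open>T\<close> is its inverse
    \<open>U\<close>.\<close>
  have "C *v z = B *v U z" for z
  proof (rule vector_eq_rdot[THEN iffD1], rule allI)
    fix x
    have "x \<bullet> (C *v z) = T (transpose B *v x) \<bullet> T (U z)"
      by (simp only: inner_matrix_vector_transpose T TU)
    also have "\<dots> = x \<bullet> (B *v U z)"
      using T(1) by (simp only: orthogonal_transformation_def inner_matrix_vector_transpose)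
    finally show "(C *v z) \<bullet> x = (B *v U z) \<bullet> x" by (simp add: inner_commute)
  qed
  then have "(*v) C = (*v) B \<circ> U" by (simp add: fun_eq_iff)
  then have "distr std_gauss borel ((*v) C) = distr std_gauss borel ((*v) B \<circ> U)" by simp
  also have "\<dots> = distr (distr std_gauss borel U) borel ((*v) B)"
  proof (rule distr_distr[symmetric])
    show "U \<in> std_gauss \<rightarrow>\<^sub>M borel"
      using borel_measurable_linear[OF orthogonal_transformation_linear[OF U]]
      by (simp cong: measurable_cong_sets)
  qed simp
  finally show ?thesis by (simp add: std_gauss_distr_orthogonal[OF U])
qed

section \<open>Factorization of positive semidefinite matrices\<close>

text \<open>Cholesky factorisation, eliminating the indices in \<open>I\<close> one at a time.\<close>
lemma psd_factorization_aux:
  fixes S :: "real^'p^'p"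
  assumes "finite I" and "transpose S = S" and "\<And>x. 0 \<le> x \<bullet> (S *v x)"
    and "\<And>i j. i \<notin> I \<Longrightarrow> S $ i $ j = 0"
  shows "\<exists>A. A ** transpose A = S \<and> (\<forall>j k. k \<notin> I \<longrightarrow> A $ j $ k = 0)"
  using assms
proof (induction I arbitrary: S rule: finite_induct)
  case empty
  then have "S = 0" by (simp add: vec_eq_iff)
  then show ?case by (intro exI[of _ 0]) (simp add: matrix_matrix_mult_def vec_eq_iff)
next
  case (insert i I S)
  have sym: "S $ j $ k = S $ k $ j" for j k
    using insert.prems(1) by (metis transpose_def vec_lambda_beta)
  define w where "w = S *v axis i 1"
  have w: "w $ j = S $ j $ i" for j
    by (simp add: w_def matrix_vector_mult_basis column_def)
  have Sw: "axis i 1 \<bullet> (S *v x) = w \<bullet> x" for x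
    unfolding w_def by (subst inner_matrix_vector_transpose) (simp add: insert.prems(1))
  define s where "s = S $ i $ i"
  have aS: "axis i 1 \<bullet> w = s" by (simp add: inner_axis' w s_def)
  \<comment> \<open>Moving along the \<open>i\<close>-th axis turns the quadratic form into a
    polynomial in \<open>t\<close> of degree at most two, and its nonnegativity drives both cases
    below.\<close>
  have form: "(x + t *\<^sub>R axis i 1) \<bullet> (S *v (x + t *\<^sub>R axis i 1)) = x \<bullet> (S *v x) + 2 * t * (w \<bullet> x) + t\<^sup>2 * s"
    for x t
    using aS
    by (simp add: matrix_vector_right_distrib matrix_vector_mult_scaleR inner_add_left inner_add_right Sw
        w_def[symmetric] inner_commute[of x w] power2_eq_square distrib_left)
  have nonneg: "0 \<le> x \<bullet> (S *v x) + 2 * t * (w \<bullet> x) + t\<^sup>2 * s" for x t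
    using insert.prems(2) form by metis
  show ?case
  proof (cases "s = 0")
    case True
    have "w $ j = 0" for j
    proof (rule ccontr)
      assume "w $ j \<noteq> 0"
      define a where "a = axis j 1 \<bullet> (S *v axis j 1)"
      \<comment> \<open>For \<open>s = 0\<close> the polynomial is affine in \<open>t\<close>, and
        the chosen \<open>t\<close> gives it the value -1.\<close>
      show False
        using nonneg[of "axis j 1" "- (a + 1) / (2 * w $ j)"] \<open>w $ j \<noteq> 0\<close> True
        by (simp add: inner_axis a_def[symmetric] field_simps)
    qed
    then have "S $ j $ i = 0" for j by (simp add: w)
    then have "\<And>j k. j \<notin> I \<Longrightarrow> S $ j $ k = 0"
      using insert.prems(3) sym by (metis insertE)
    then show ?thesis using insert.IH[OF insert.prems(1,2)] by blast
  next
    case False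
    have "s \<ge> 0" using nonneg[of 0 1] by (simp add: matrix_vector_mult_0_right)
    with False have s: "s > 0" by simp
    \<comment> \<open>The Schur complement of the pivot \<open>s\<close>: subtracting this rank one
      term clears row and column \<open>i\<close>.\<close>
    define S' where "S' = (\<chi> j k. S $ j $ k - w $ j * w $ k / s)"
    have S'v: "S' *v x = S *v x - ((w \<bullet> x) / s) *\<^sub>R w" for x
      by (simp add: vec_eq_iff S'_def matrix_vector_mult_def inner_vec_def right_diff_distrib
          sum_subtractf sum_divide_distrib sum_distrib_left mult_ac)
    have psd: "0 \<le> x \<bullet> (S' *v x)" for x
    proof -
      \<comment> \<open>This \<open>t\<close> minimizes the polynomial, and the minimum is exactly
        the form of \<open>S'\<close>.\<close>
      have "0 \<le> x \<bullet> (S *v x) + 2 * (- (w \<bullet> x) / s) * (w \<bullet> x) + (- (w \<bullet> x) / s)\<^sup>2 * s"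
        by (rule nonneg)
      also have "\<dots> = x \<bullet> (S' *v x)"
        using s by (simp add: S'v inner_diff_right inner_commute[of x w] power2_eq_square field_simps)
      finally show ?thesis .
    qed
    have "\<exists>A. A ** transpose A = S' \<and> (\<forall>j k. k \<notin> I \<longrightarrow> A $ j $ k = 0)"
    proof (rule insert.IH[OF _ psd])
      show "transpose S' = S'" by (simp add: vec_eq_iff transpose_def S'_def sym mult.commute)
      fix j k assume "j \<notin> I"
      then show "S' $ j $ k = 0"
        using insert.prems(3)[of j] s by (cases "j = i") (simp_all add: S'_def w s_def sym[of k i])
    qed
    then obtain A :: "real^'p^'p" where A: "A ** transpose A = S'" "\<And>j k. k \<notin> I \<Longrightarrow> A $ j $ k = 0" by blast
    \<comment> \<open>Column \<open>i\<close> of \<open>A\<close> vanishes because \<open>i\<close>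
      lies outside \<open>I\<close>, so it is free to carry the rank one term. This is why the
      induction keeps track of zero columns.\<close>
    define B where "B = (\<chi> j k. if k = i then w $ j / sqrt s else A $ j $ k)"
    have "(B ** transpose B) $ j $ k = S $ j $ k" for j k
    proof -
      have "(B ** transpose B) $ j $ k = (\<Sum>l\<in>UNIV. B $ j $ l * B $ k $ l)"
        by (simp add: matrix_matrix_mult_def transpose_def)
      also have "\<dots> = (\<Sum>l\<in>UNIV. A $ j $ l * A $ k $ l + (if l = i then w $ j * w $ k / s else 0))"
        using s A(2)[OF insert.hyps(2)] by (intro sum.cong) (auto simp: B_def)
      also have "\<dots> = (A ** transpose A) $ j $ k + w $ j * w $ k / s"
        by (simp add: sum.distrib matrix_matrix_mult_def transpose_def)
      finally show ?thesis by (simp add: A(1) S'_def)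
    qed
    then have "B ** transpose B = S" by (simp add: vec_eq_iff)
    moreover have "\<forall>j k. k \<notin> insert i I \<longrightarrow> B $ j $ k = 0" by (simp add: B_def A(2))
    ultimately show ?thesis by blast
  qed
qed

lemma psd_factorization:
  fixes S :: "real^'p^'p"
  assumes "transpose S = S" and "\<And>x. 0 \<le> x \<bullet> (S *v x)"
  shows "\<exists>A :: real^'p^'p. A ** transpose A = S"
  using psd_factorization_aux[of UNIV S] assms by auto

section \<open>Gaussian laws and their covariance\<close>

text \<open>One root \<open>B\<close> ensures that \<open>SOME\<close> returns a genuine root, and
  all roots give the same image law.\<close>

lemma mvn0_eq:
  fixes B S :: "real^'p^'p"
  assumes "B ** transpose B = S"
  shows "mvn0 S = distr std_gauss borel ((*v) B)"
proof -
  have "(SOME A :: real^'p^'p. A ** transpose A = S) ** transpose (SOME A :: real^'p^'p. A ** transpose A = S) = S"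
    using assms by (rule someI)
  then show ?thesis unfolding mvn0_def
    by (intro std_gauss_distr_matrix_cong) (simp add: assms)
qed

lemma sets_mvn0 [simp, measurable_cong]: "sets (mvn0 S) = sets borel"
  by (simp add: mvn0_def)

text \<open>Positive semidefiniteness supplies a root \<open>A\<close> of \<open>S\<close>, and
  \<open>B ** A\<close> is then a root of the transformed covariance.\<close>

lemma mvn0_distr_matrix:
  fixes S B :: "real^'p^'p"
  assumes "transpose S = S" and "\<And>x. 0 \<le> x \<bullet> (S *v x)"
  shows "distr (mvn0 S) borel ((*v) B) = mvn0 (B ** S ** transpose B)"
proof -
  obtain A :: "real^'p^'p" where A: "A ** transpose A = S" using psd_factorization[OF assms] by blast
  have "(B ** A) ** transpose (B ** A) = B ** S ** transpose B"
    by (simp add: A[symmetric] matrix_transpose_mul matrix_mul_assoc)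
  then have "mvn0 (B ** S ** transpose B) = distr std_gauss borel ((*v) (B ** A))"
    by (rule mvn0_eq)
  also have "(*v) (B ** A) = (*v) B \<circ> (*v) A"
    by (simp add: fun_eq_iff matrix_vector_mul_assoc)
  also have "distr std_gauss borel ((*v) B \<circ> (*v) A) = distr (mvn0 S) borel ((*v) B)"
    by (simp add: mvn0_eq[OF A] distr_distr)
  finally show ?thesis by simp
qed

subsection \<open>Gradients and Hessians\<close>

lemma has_derivative_grad:
  assumes "f differentiable (at x)"
  shows "(f has_derivative (\<lambda>h. grad f x \<bullet> h)) (at x)"
proof -
  let ?D = "frechet_derivative f (at x)"
  have D: "(f has_derivative ?D) (at x)" using assms by (simp add: frechet_derivative_works)
  then interpret linear ?D by (rule has_derivative_linear)
  have "?D h = grad f x \<bullet> h" for h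
  proof -
    have "?D h = ?D (\<Sum>i\<in>UNIV. h $ i *\<^sub>R axis i 1)"
      by (simp add: basis_expansion flip: scalar_mult_eq_scaleR)
    then show ?thesis
      by (simp add: sum scale grad_def inner_vec_def mult.commute)
  qed
  then have "?D = (\<lambda>h. grad f x \<bullet> h)" by (rule ext)
  with D show ?thesis by simp
qed

text \<open>\<open>hess\<close> puts the direction of differentiation in the column index, so it is
  the Jacobian matrix of \<open>grad f\<close>.\<close>

lemma has_derivative_hess:
  assumes "grad f differentiable (at x)"
  shows "(grad f has_derivative (*v) (hess f x)) (at x)"
proof -
  let ?D = "frechet_derivative (grad f) (at x)"
  have D: "(grad f has_derivative ?D) (at x)" using assms by (simp add: frechet_derivative_works)
  then have "linear ?D" by (rule has_derivative_linear)
  then have "?D = (*v) (matrix ?D)" by (simp add: fun_eq_iff matrix_works)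
  also have "matrix ?D = hess f x" by (simp add: hess_def matrix_def)
  finally show ?thesis using D by simp
qed

section \<open>Symmetry of the Hessian\<close>

text \<open>The second difference is symmetric in \<open>u\<close> and \<open>v\<close>, while its
  approximation by the form of \<open>B\<close> need not be; comparing the two orders is Young's
  proof of the symmetry of second derivatives. The mean value theorem in direction \<open>u\<close>
  reduces the claim to a difference of two gradients, each expanded to first order at
  \<open>x\<close>.\<close>

lemma second_difference_bound:
  fixes f :: "real^'p \<Rightarrow> real"
  assumes f: "\<And>y. norm (y - x) < d \<Longrightarrow> f differentiable (at y)"
    and r: "\<And>y. norm (y - x) < d \<Longrightarrow> norm (grad f y - grad f x - B *v (y - x)) \<le> e * norm (y - x)"
    and t: "0 < t" "t * (norm u + norm v) < d" and e: "0 \<le> e"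
  shows "\<bar>f (x + t *\<^sub>R u + t *\<^sub>R v) - f (x + t *\<^sub>R u) - f (x + t *\<^sub>R v) + f x - t\<^sup>2 * (u \<bullet> (B *v v))\<bar>
    \<le> 2 * e * t\<^sup>2 * (norm u + norm v)\<^sup>2"
proof -
  \<comment> \<open>Two parallel segments in direction \<open>u\<close>, the second displaced by
    \<open>t *\<^sub>R v\<close>; \<open>\<phi>\<close> is the increment of \<open>f\<close> between
    them.\<close>
  define a where "a s = x + (s * t) *\<^sub>R u" for s
  define b where "b s = x + (s * t) *\<^sub>R u + t *\<^sub>R v" for s
  have na: "norm (a s - x) \<le> t * (norm u + norm v)" and nb: "norm (b s - x) \<le> t * (norm u + norm v)"
    if "s \<in> {0..1}" for s
  proof -
    have *: "norm ((s * t) *\<^sub>R u) \<le> t * norm u"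
      using that t(1) by (simp add: abs_mult mult_right_mono mult_left_le_one_le)
    then show "norm (a s - x) \<le> t * (norm u + norm v)"
      using t(1) by (simp add: a_def distrib_left) (smt (verit) mult_nonneg_nonneg norm_ge_zero)
    have "norm (b s - x) \<le> norm ((s * t) *\<^sub>R u) + norm (t *\<^sub>R v)"
      unfolding b_def by (metis add.assoc add_diff_cancel_left' norm_triangle_ineq)
    then show "norm (b s - x) \<le> t * (norm u + norm v)"
      using * t(1) by (simp add: distrib_left)
  qed
  define \<phi> where "\<phi> s = f (b s) - f (a s)" for s
  have der: "(\<phi> has_derivative (\<lambda>h. grad f (b s) \<bullet> ((h * t) *\<^sub>R u) - grad f (a s) \<bullet> ((h * t) *\<^sub>R u))) (at s within {0..1})"
    if "s \<in> {0..1}" for s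
  proof -
    have da: "(a has_derivative (\<lambda>h. (h * t) *\<^sub>R u)) (at s within {0..1})"
      unfolding a_def by (auto intro!: derivative_eq_intros)
    have db: "(b has_derivative (\<lambda>h. (h * t) *\<^sub>R u)) (at s within {0..1})"
      unfolding b_def by (auto intro!: derivative_eq_intros)
    have "(f has_derivative (\<lambda>h. grad f (a s) \<bullet> h)) (at (a s))" "(f has_derivative (\<lambda>h. grad f (b s) \<bullet> h)) (at (b s))"
      using na[OF that] nb[OF that] t(2) by (auto intro!: has_derivative_grad f)
    then show ?thesis
      unfolding \<phi>_def
      by (intro has_derivative_diff has_derivative_compose[OF da] has_derivative_compose[OF db])
  qed
  have "\<exists>s\<in>{0<..<1}. \<phi> 1 - \<phi> 0 =
      grad f (b s) \<bullet> (((1 - 0) * t) *\<^sub>R u) - grad f (a s) \<bullet> (((1 - 0) * t) *\<^sub>R u)"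
    by (rule mvt_simple, simp, rule der, simp)
  then obtain s where s: "s \<in> {0<..<1}"
    and "\<phi> 1 - \<phi> 0 = grad f (b s) \<bullet> (((1 - 0) * t) *\<^sub>R u) - grad f (a s) \<bullet> (((1 - 0) * t) *\<^sub>R u)"
    by blast
  then have eq: "\<phi> 1 - \<phi> 0 = t * (u \<bullet> (grad f (b s) - grad f (a s)))"
    by (simp add: inner_diff_right inner_commute right_diff_distrib)
  have s01: "s \<in> {0..1}" using s by simp
  define p where "p y = grad f y - grad f x - B *v (y - x)" for y
  have p: "norm (p y) \<le> e * (t * (norm u + norm v))" if "norm (y - x) \<le> t * (norm u + norm v)" for y
    using r[of y] that t(2) e unfolding p_def by (smt (verit) mult_left_mono)
  have "grad f (b s) - grad f (a s) = B *v (t *\<^sub>R v) + (p (b s) - p (a s))"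
    by (simp add: p_def a_def b_def matrix_vector_right_distrib)
  then have "\<phi> 1 - \<phi> 0 - t\<^sup>2 * (u \<bullet> (B *v v)) = t * (u \<bullet> (p (b s) - p (a s)))"
    by (simp add: eq inner_add_right matrix_vector_mult_scaleR distrib_left power2_eq_square)
  also have "\<bar>\<dots>\<bar> \<le> t * (norm u * norm (p (b s) - p (a s)))"
    using t(1) Cauchy_Schwarz_ineq2[of u "p (b s) - p (a s)"] by (simp add: abs_mult)
  also have "\<dots> \<le> t * ((norm u + norm v) * (2 * (e * (t * (norm u + norm v)))))"
  proof (intro mult_left_mono mult_mono)
    show "norm (p (b s) - p (a s)) \<le> 2 * (e * (t * (norm u + norm v)))"
      using p[OF na[OF s01]] p[OF nb[OF s01]] norm_triangle_ineq4[of "p (b s)" "p (a s)"] by simp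
  qed (use t(1) in auto)
  also have "\<dots> = 2 * e * t\<^sup>2 * (norm u + norm v)\<^sup>2" by (simp add: power2_eq_square mult_ac)
  finally show ?thesis by (simp add: \<phi>_def a_def b_def algebra_simps)
qed

lemma transpose_hess:
  fixes f :: "real^'p \<Rightarrow> real"
  assumes N: "open N" "x \<in> N" and f: "\<And>y. y \<in> N \<Longrightarrow> f differentiable (at y)"
    and g: "grad f differentiable (at x)"
  shows "transpose (hess f x) = hess f x"
proof -
  define B where "B = hess f x"
  have sym: "u \<bullet> (B *v v) = v \<bullet> (B *v u)" for u v
  proof -
    have le: "\<bar>u \<bullet> (B *v v) - v \<bullet> (B *v u)\<bar> \<le> 4 * (norm u + norm v)\<^sup>2 * e" if e: "e > 0" for e
    proof -
      have "(grad f has_derivative (*v) B) (at x)" unfolding B_def using g by (rule has_derivative_hess)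
      then obtain d1 where d1: "d1 > 0"
        "\<And>y. norm (y - x) < d1 \<Longrightarrow> norm (grad f y - grad f x - B *v (y - x)) \<le> e * norm (y - x)"
        unfolding has_derivative_at_alt using e by blast
      obtain d2 where d2: "d2 > 0" "ball x d2 \<subseteq> N" using N openE by blast
      define d where "d = min d1 d2"
      have d: "d > 0" using d1 d2 by (simp add: d_def)
      have fd: "f differentiable (at y)" if "norm (y - x) < d" for y
        using that d2 by (intro f) (auto simp: d_def dist_norm norm_minus_commute)
      have rd: "norm (grad f y - grad f x - B *v (y - x)) \<le> e * norm (y - x)" if "norm (y - x) < d" for y
        using that d1 by (simp add: d_def)
      \<comment> \<open>Half of the admissible scale; the added 1 keeps the denominator positive
        when \<open>u\<close> and \<open>v\<close> are both 0.\<close>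
      define t where "t = d / (2 * (norm u + norm v + 1))"
      have pos: "norm u + norm v + 1 > 0" by (smt (verit) norm_ge_zero)
      have t: "t > 0" using d pos by (simp add: t_def)
      have "2 * (t * (norm u + norm v + 1)) = d" using pos unfolding t_def by (simp add: divide_simps)
      then have td: "t * (norm u + norm v) < d" "t * (norm v + norm u) < d"
        using t d by (simp_all add: distrib_left)
      have "t\<^sup>2 * \<bar>u \<bullet> (B *v v) - v \<bullet> (B *v u)\<bar> = \<bar>t\<^sup>2 * (u \<bullet> (B *v v)) - t\<^sup>2 * (v \<bullet> (B *v u))\<bar>"
        by (simp add: abs_mult flip: right_diff_distrib)
      also have "\<dots> \<le> 4 * e * t\<^sup>2 * (norm u + norm v)\<^sup>2"
        using second_difference_bound[OF fd rd t td(1)] second_difference_bound[OF fd rd t td(2)] e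
        by (simp add: add.commute[of "norm v"] add.assoc add.commute[of "t *\<^sub>R v"])
      also have "\<dots> = t\<^sup>2 * (4 * (norm u + norm v)\<^sup>2 * e)" by simp
      finally show ?thesis using t by simp
    qed
    show ?thesis
    proof (rule ccontr)
      define K where "K = 4 * (norm u + norm v)\<^sup>2"
      define b where "b = \<bar>u \<bullet> (B *v v) - v \<bullet> (B *v u)\<bar>"
      assume "u \<bullet> (B *v v) \<noteq> v \<bullet> (B *v u)"
      then have b: "b > 0" by (simp add: b_def)
      have K: "K \<ge> 0" by (simp add: K_def)
      \<comment> \<open>With this value as \<open>e\<close> the bound \<open>le\<close> would give
        \<open>b\<close> at most half of itself.\<close>
      have "b / (2 * (K + 1)) > 0" using b K by simp
      then have "b \<le> K * (b / (2 * (K + 1)))" using le unfolding K_def b_def by blast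
      then have "b * (2 * (K + 1)) \<le> K * b" using K b by (simp add: field_simps)
      with b K show False by (simp add: algebra_simps) (smt (verit) mult_nonneg_nonneg)
    qed
  qed
  have "B $ i $ j = B $ j $ i" for i j
    using sym[of "axis i 1" "axis j 1"] by (simp add: inner_axis' matrix_vector_mult_basis column_def)
  then show ?thesis by (simp add: vec_eq_iff transpose_def B_def)
qed

section \<open>Linearized gradients and maximizers\<close>

text \<open>The norm of this matrix type is the Frobenius norm, so Cauchy-Schwarz applied row by row
  suffices.\<close>

lemma norm_matrix_vector_le:
  fixes A :: "real^'n^'m"
  shows "norm (A *v x) \<le> norm A * norm x"
proof -
  have "norm (A *v x) \<le> L2_set (\<lambda>i. norm (A $ i) * norm x) UNIV"
    unfolding norm_vec_def[of "A *v x"]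
    by (rule L2_set_mono) (simp_all add: matrix_mult_dot Cauchy_Schwarz_ineq2)
  also have "\<dots> = norm A * norm x"
    by (simp add: L2_set_left_distrib[symmetric] norm_vec_def[of A])
  finally show ?thesis .
qed

text \<open>The mean value inequality is applied to \<open>grad f z - A *v z\<close>, whose
  derivative has operator norm at most \<open>\<eta>\<close>. For a vector-valued gradient this
  takes the place of an expansion at a single intermediate point.\<close>

lemma grad_linearization:
  fixes f :: "real^'p \<Rightarrow> real"
  assumes S: "convex S" "x \<in> S" "y \<in> S"
    and f: "\<And>z. z \<in> S \<Longrightarrow> grad f differentiable (at z)"
    and A: "\<And>z. z \<in> S \<Longrightarrow> norm (hess f z - A) \<le> \<eta>"
  shows "norm (grad f y - grad f x - A *v (y - x)) \<le> \<eta> * norm (y - x)"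
proof -
  define g where "g z = grad f z - A *v z" for z
  have "(g has_derivative (\<lambda>h. (hess f z - A) *v h)) (at z within S)" if "z \<in> S" for z
  proof -
    have "((*v) A has_derivative (*v) A) (at z)"
      by (rule bounded_linear_imp_has_derivative) (rule matrix_vector_mul_bounded_linear)
    with has_derivative_hess[OF f[OF that]]
    have "(g has_derivative (\<lambda>h. hess f z *v h - A *v h)) (at z)"
      unfolding g_def by (rule has_derivative_diff)
    then show ?thesis
      unfolding matrix_vector_mult_diff_rdistrib by (rule has_derivative_at_withinI)
  qed
  moreover have "onorm ((*v) (hess f z - A)) \<le> \<eta>" if "z \<in> S" for z
  proof (rule onorm_bound)
    show "0 \<le> \<eta>" using A[OF that] norm_ge_zero order_trans by blast
    show "norm ((hess f z - A) *v h) \<le> \<eta> * norm h" for h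
      using norm_matrix_vector_le[of "hess f z - A" h] A[OF that]
      by (meson mult_right_mono norm_ge_zero order_trans)
  qed
  ultimately have "norm (g y - g x) \<le> \<eta> * norm (y - x)"
    using S by (intro differentiable_bound[of S g "\<lambda>z h. (hess f z - A) *v h"])
  then show ?thesis by (simp add: g_def matrix_vector_mult_diff_distrib algebra_simps)
qed

lemma grad_eq_0_at_max:
  fixes f :: "real^'p \<Rightarrow> real"
  assumes "x \<in> interior S" "\<And>y. y \<in> S \<Longrightarrow> f y \<le> f x" "f differentiable (at x)"
  shows "grad f x = 0"
proof -
  have "(\<lambda>h. grad f x \<bullet> h) = (\<lambda>h. 0)"
    using assms interior_subset[of S]
    by (intro differential_zero_maxmin[OF assms(1) open_interior has_derivative_grad[OF assms(3)]]) auto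
  then show ?thesis by (metis inner_eq_zero_iff)
qed

text \<open>Outside the ball, compactness yields a best competitor \<open>z\<close> with value
  strictly below \<open>f x\<close>; half of that gap serves as \<open>e\<close>.\<close>

lemma well_separated_max:
  fixes f :: "'a::metric_space \<Rightarrow> real"
  assumes "compact K" "continuous_on K f" "\<And>y. y \<in> K \<Longrightarrow> y \<noteq> x \<Longrightarrow> f y < f x" "0 < d"
  shows "\<exists>e>0. \<forall>y\<in>K. f x - e \<le> f y \<longrightarrow> dist x y < d"
proof (cases "K - ball x d = {}")
  case True
  then show ?thesis by (intro exI[of _ 1]) auto
next
  case False
  have "compact (K - ball x d)" using assms(1) by (simp add: compact_diff)
  then obtain z where z: "z \<in> K - ball x d" "\<And>y. y \<in> K - ball x d \<Longrightarrow> f y \<le> f z"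
    using continuous_attains_sup[OF _ False, of f] assms(2) continuous_on_subset by blast
  then have "f z < f x" using assms(3,4) by (metis Diff_iff centre_in_ball)
  then show ?thesis using z(2) by (intro exI[of _ "(f x - f z) / 2"]) (force simp: field_simps)
qed

subsection \<open>Convergence in distribution\<close>

text \<open>The exceptional set \<open>E\<close> is explicit because \<open>P n\<close> need not be a measurable event.\<close>
definition eventually_prob :: "'a measure \<Rightarrow> real \<Rightarrow> (nat \<Rightarrow> 'a \<Rightarrow> bool) \<Rightarrow> bool" where
  "eventually_prob M e P \<longleftrightarrow>
     (\<forall>\<^sub>F n in sequentially. \<exists>E\<in>sets M. measure M E < e \<and> (\<forall>\<omega>\<in>space M - E. P n \<omega>))"

lemma eventually_prob_mono:
  assumes "eventually_prob M e P" "\<And>n \<omega>. \<omega> \<in> space M \<Longrightarrow> P n \<omega> \<Longrightarrow> R n \<omega>"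
  shows "eventually_prob M e R"
  using assms(1) unfolding eventually_prob_def
  by (rule eventually_mono) (use assms(2) in blast)

lemma eventually_prob_conj:
  assumes "finite_measure M" "eventually_prob M e1 P" "eventually_prob M e2 R"
  shows "eventually_prob M (e1 + e2) (\<lambda>n \<omega>. P n \<omega> \<and> R n \<omega>)"
  using assms(2,3) unfolding eventually_prob_def
proof eventually_elim
  case (elim n)
  then obtain E F where E: "E \<in> sets M" "measure M E < e1" "\<forall>\<omega>\<in>space M - E. P n \<omega>"
    and F: "F \<in> sets M" "measure M F < e2" "\<forall>\<omega>\<in>space M - F. R n \<omega>" by blast
  have "measure M (E \<union> F) < e1 + e2"
    using measure_Un_le[OF E(1) F(1)] E(2) F(2) by simp
  with E F show ?case by (intro bexI[of _ "E \<union> F"]) auto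
qed

lemma eventually_prob_unif_plim0:
  assumes "unif_plim0 M D S" "0 < \<epsilon>" "0 < e"
  shows "eventually_prob M e (\<lambda>n \<omega>. \<forall>\<theta>\<in>S. D n \<omega> \<theta> \<le> \<epsilon>)"
proof -
  let ?E = "\<lambda>n. {\<omega>\<in>space M. \<exists>\<theta>\<in>S. D n \<omega> \<theta> > \<epsilon>}"
  have "\<forall>\<^sub>F n in sequentially. measure M (?E n) < e"
    using assms unfolding unif_plim0_def by (intro order_tendstoD(2)) auto
  then show ?thesis unfolding eventually_prob_def
  proof eventually_elim
    case (elim n)
    have "?E n \<in> sets M" using assms(1) by (simp add: unif_plim0_def)
    with elim show ?case by (intro bexI[of _ "?E n"]) (auto simp: not_less)
  qed
qed

lemma eventually_prob_AE:
  assumes "\<And>n. AE \<omega> in M. P n \<omega>" "0 < e"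
  shows "eventually_prob M e P"
  unfolding eventually_prob_def
proof (intro always_eventually allI)
  fix n
  obtain E where "E \<in> null_sets M" "{\<omega>\<in>space M. \<not> P n \<omega>} \<subseteq> E"
    using assms(1)[of n] by (auto simp: eventually_ae_filter)
  then show "\<exists>E\<in>sets M. measure M E < e \<and> (\<forall>\<omega>\<in>space M - E. P n \<omega>)"
    using assms(2) by (intro bexI[of _ E]) (auto simp: measure_eq_0_null_sets)
qed

text \<open>Testing against the constant 1 transfers the total mass to the limit. It is the source
  of the normalization of \<open>mvn0\<close> in the tightness argument.\<close>

lemma conv_distr_prob_space:
  assumes "prob_space M" "conv_distr M X \<mu>"
  shows "prob_space \<mu>"
proof -
  interpret prob_space M by fact
  have "(\<lambda>n. integral\<^sup>L M (\<lambda>\<omega>. 1::real)) \<longlonglongrightarrow> integral\<^sup>L \<mu> (\<lambda>x. 1)"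
    using assms(2)[unfolded conv_distr_def, THEN conjunct2, rule_format, of "\<lambda>_. 1"] by simp
  then have "measure \<mu> (space \<mu>) = 1"
    by (simp add: prob_space LIMSEQ_const_iff)
  \<comment> \<open>\<open>measure\<close> is 0 on a set of infinite mass, so the value 1 excludes
    that case.\<close>
  then have "emeasure \<mu> (space \<mu>) = 1"
    by (metis emeasure_eq_ennreal_measure ennreal_1 measure_zero_top zero_neq_one)
  then show ?thesis by (rule prob_spaceI)
qed

lemma integrable_continuous_bounded:
  fixes f :: "'b::euclidean_space \<Rightarrow> real"
  assumes "finite_measure M" "X \<in> borel_measurable M" "continuous_on UNIV f" "bounded (range f)"
  shows "integrable M (\<lambda>\<omega>. f (X \<omega>))"
proof -
  obtain B where "\<And>x. norm (f x) \<le> B" using assms(4) by (auto simp: bounded_iff)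
  moreover have "(\<lambda>\<omega>. f (X \<omega>)) \<in> borel_measurable M"
    using borel_measurable_continuous_onI[OF assms(3)] assms(2) by measurable
  ultimately show ?thesis
    by (intro finite_measure.integrable_const_bound[OF assms(1), of _ B]) auto
qed

lemma conv_distr_tight:
  fixes X :: "nat \<Rightarrow> 'a \<Rightarrow> 'b::euclidean_space"
  assumes M: "prob_space M" and X: "conv_distr M X \<mu>" and sets[measurable_cong]: "sets \<mu> = sets borel"
    and e: "0 < e"
  shows "\<exists>R\<ge>0. eventually_prob M e (\<lambda>n \<omega>. norm (X n \<omega>) \<le> R)"
proof -
  interpret prob_space M by fact
  interpret \<mu>: prob_space \<mu> using M X by (rule conv_distr_prob_space)
  have [measurable]: "X n \<in> borel_measurable M" for n using X by (simp add: conv_distr_def)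
  \<comment> \<open>A continuous ramp, 0 up to radius \<open>k\<close> and 1 from radius
    \<open>k + 1\<close> on. It dominates the indicator of the event that \<open>X n\<close> leaves
    the larger ball, and its limiting integral tends to 0 by dominated convergence.\<close>
  define g where "g k x = max 0 (min 1 (norm x - real k))" for k and x :: 'b
  have g: "continuous_on UNIV (g k)" "bounded (range (g k))" for k
    unfolding g_def by (auto intro!: continuous_intros exI[of _ 1] simp: bounded_iff)
  have [measurable]: "g k \<in> borel_measurable borel" for k
    by (rule borel_measurable_continuous_onI) (rule g)
  have "(\<lambda>k. integral\<^sup>L \<mu> (g k)) \<longlonglongrightarrow> integral\<^sup>L \<mu> (\<lambda>x. 0)"
  proof (rule integral_dominated_convergence[where w="\<lambda>_. 1"])
    show "AE x in \<mu>. (\<lambda>k. g k x) \<longlonglongrightarrow> 0"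
    proof (rule AE_I2, rule tendsto_eventually)
      fix x :: 'b
      obtain K :: nat where K: "norm x \<le> real K" using real_arch_simple by blast
      show "\<forall>\<^sub>F k in sequentially. g k x = 0"
        using eventually_ge_at_top[of K] by eventually_elim (use K in \<open>auto simp: g_def\<close>)
    qed
  qed (auto simp: g_def)
  then have "\<forall>\<^sub>F k in sequentially. integral\<^sup>L \<mu> (g k) < e"
    using e by (intro order_tendstoD(2)[where a=e]) auto
  then obtain k where k: "integral\<^sup>L \<mu> (g k) < e" by (auto dest: eventually_happens)
  have "(\<lambda>n. integral\<^sup>L M (\<lambda>\<omega>. g k (X n \<omega>))) \<longlonglongrightarrow> integral\<^sup>L \<mu> (g k)"
    using X g unfolding conv_distr_def by blast
  then have "\<forall>\<^sub>F n in sequentially. integral\<^sup>L M (\<lambda>\<omega>. g k (X n \<omega>)) < e"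
    using k by (rule order_tendstoD(2))
  then have "eventually_prob M e (\<lambda>n \<omega>. norm (X n \<omega>) \<le> real k + 1)"
    unfolding eventually_prob_def
  proof eventually_elim
    case (elim n)
    define E where "E = {\<omega>\<in>space M. norm (X n \<omega>) > real k + 1}"
    have [measurable]: "E \<in> sets M" unfolding E_def by measurable
    have "measure M E = integral\<^sup>L M (indicator E)" by simp
    also have "\<dots> \<le> integral\<^sup>L M (\<lambda>\<omega>. g k (X n \<omega>))"
    proof (rule integral_mono)
      show "integrable M (\<lambda>\<omega>. g k (X n \<omega>))"
        using g by (intro integrable_continuous_bounded) (auto intro: finite_measure_axioms)
      show "integrable M (indicator E :: 'a \<Rightarrow> real)"
        by (simp add: less_top[symmetric])
    qed (auto simp: E_def g_def indicator_def)
    also note elim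
    finally show ?case by (intro bexI[of _ E]) (auto simp: E_def not_less)
  qed
  then show ?thesis by (intro exI[of _ "real k + 1"]) auto
qed

text \<open>A bounded continuous \<open>f\<close> is uniformly continuous on balls, and tightness of
  \<open>X\<close> confines both sequences to one ball outside a small event. On that event the
  integrands differ by at most \<open>2 * B\<close>.\<close>

lemma conv_distr_Slutsky:
  fixes X Y :: "nat \<Rightarrow> 'a \<Rightarrow> 'b::euclidean_space"
  assumes M: "prob_space M" and X: "conv_distr M X \<mu>" and sets: "sets \<mu> = sets borel"
    and Y: "\<And>n. Y n \<in> borel_measurable M"
    and diff: "\<And>\<epsilon> e. 0 < \<epsilon> \<Longrightarrow> 0 < e \<Longrightarrow> eventually_prob M e (\<lambda>n \<omega>. norm (Y n \<omega> - X n \<omega>) \<le> \<epsilon>)"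
  shows "conv_distr M Y \<mu>"
  unfolding conv_distr_def
proof (intro conjI allI impI Y)
  interpret prob_space M by fact
  have Xm: "X n \<in> borel_measurable M" for n using X by (simp add: conv_distr_def)
  fix f :: "'b \<Rightarrow> real" assume f: "continuous_on UNIV f \<and> bounded (range f)"
  have intX: "integrable M (\<lambda>\<omega>. f (X n \<omega>))" and intY: "integrable M (\<lambda>\<omega>. f (Y n \<omega>))" for n
    using f Xm Y finite_measure_axioms integrable_continuous_bounded by blast+
  obtain B where B: "B > 0" "\<And>x. \<bar>f x\<bar> \<le> B" using f by (auto simp: bounded_pos)
  have "(\<lambda>n. integral\<^sup>L M (\<lambda>\<omega>. f (Y n \<omega>)) - integral\<^sup>L M (\<lambda>\<omega>. f (X n \<omega>))) \<longlonglongrightarrow> 0"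
  proof (rule LIMSEQ_I)
    fix r :: real assume r: "r > 0"
    \<comment> \<open>Two exceptional events of probability below \<open>e\<close> contribute less
      than \<open>4 * B * e = r / 2\<close>; the modulus of continuity accounts for the other half
      of \<open>r\<close>.\<close>
    define e where "e = r / (8 * B)"
    have e: "e > 0" using r B by (simp add: e_def)
    obtain R where R: "eventually_prob M e (\<lambda>n \<omega>. norm (X n \<omega>) \<le> R)"
      using conv_distr_tight[OF M X sets e] by blast
    have "uniformly_continuous_on (cball 0 (R + 1)) f"
      using f by (intro compact_uniformly_continuous) (auto intro: continuous_on_subset)
    then obtain d where d: "d > 0"
      "\<And>x y. x \<in> cball 0 (R + 1) \<Longrightarrow> y \<in> cball 0 (R + 1) \<Longrightarrow> dist x y < d \<Longrightarrow> dist (f x) (f y) < r / 2"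
      unfolding uniformly_continuous_on_def using r by (metis half_gt_zero)
    \<comment> \<open>The bound 1 keeps \<open>Y n \<omega>\<close> in the ball of radius
      \<open>R + 1\<close> on which \<open>d\<close> was obtained.\<close>
    define \<delta> where "\<delta> = min 1 (d / 2)"
    have \<delta>: "\<delta> > 0" "\<delta> \<le> 1" "\<delta> < d" using d(1) by (auto simp: \<delta>_def)
    have "eventually_prob M (e + e) (\<lambda>n \<omega>. norm (X n \<omega>) \<le> R \<and> norm (Y n \<omega> - X n \<omega>) \<le> \<delta>)"
      using finite_measure_axioms R diff[OF \<delta>(1) e] by (rule eventually_prob_conj)
    then have "eventually_prob M (e + e) (\<lambda>n \<omega>. \<bar>f (Y n \<omega>) - f (X n \<omega>)\<bar> \<le> r / 2)"
    proof (rule eventually_prob_mono)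
      fix n \<omega> assume *: "norm (X n \<omega>) \<le> R \<and> norm (Y n \<omega> - X n \<omega>) \<le> \<delta>"
      then have "norm (Y n \<omega>) \<le> R + 1"
        using \<delta>(2) norm_triangle_ineq[of "Y n \<omega> - X n \<omega>" "X n \<omega>"] by simp
      then show "\<bar>f (Y n \<omega>) - f (X n \<omega>)\<bar> \<le> r / 2"
        using d(2)[of "Y n \<omega>" "X n \<omega>"] * \<delta>(3) by (simp add: dist_norm)
    qed
    then have "\<forall>\<^sub>F n in sequentially. \<bar>integral\<^sup>L M (\<lambda>\<omega>. f (Y n \<omega>)) - integral\<^sup>L M (\<lambda>\<omega>. f (X n \<omega>))\<bar> < r"
      unfolding eventually_prob_def
    proof eventually_elim
      case (elim n)
      then obtain E where E: "E \<in> sets M" "prob E < e + e"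
        "\<And>\<omega>. \<omega> \<in> space M - E \<Longrightarrow> \<bar>f (Y n \<omega>) - f (X n \<omega>)\<bar> \<le> r / 2" by blast
      have "\<bar>integral\<^sup>L M (\<lambda>\<omega>. f (Y n \<omega>)) - integral\<^sup>L M (\<lambda>\<omega>. f (X n \<omega>))\<bar>
          = \<bar>integral\<^sup>L M (\<lambda>\<omega>. f (Y n \<omega>) - f (X n \<omega>))\<bar>"
        using intX intY by simp
      also have "\<dots> \<le> integral\<^sup>L M (\<lambda>\<omega>. \<bar>f (Y n \<omega>) - f (X n \<omega>)\<bar>)"
        by (rule integral_abs_bound)
      also have "\<dots> \<le> integral\<^sup>L M (\<lambda>\<omega>. r / 2 + 2 * B * indicator E \<omega>)"
      proof (rule integral_mono)
        show "integrable M (\<lambda>\<omega>. \<bar>f (Y n \<omega>) - f (X n \<omega>)\<bar>)" using intX intY by auto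
        show "integrable M (\<lambda>\<omega>. r / 2 + 2 * B * indicator E \<omega>)"
          using E(1) by (auto simp: less_top[symmetric])
        fix \<omega> assume "\<omega> \<in> space M"
        then show "\<bar>f (Y n \<omega>) - f (X n \<omega>)\<bar> \<le> r / 2 + 2 * B * indicator E \<omega>"
          using E(3)[of \<omega>] B(2)[of "Y n \<omega>"] B(2)[of "X n \<omega>"] r by (cases "\<omega> \<in> E") auto
      qed
      also have "\<dots> = r / 2 + 2 * B * prob E"
        using E(1) by (subst Bochner_Integration.integral_add) (auto simp: prob_space less_top[symmetric])
      also have "\<dots> < r / 2 + 2 * B * (e + e)" using E(2) B(1) by simp
      also have "\<dots> = r" using B(1) by (simp add: e_def)
      finally show ?case .
    qed
    then show "\<exists>n0. \<forall>n\<ge>n0. norm (integral\<^sup>L M (\<lambda>\<omega>. f (Y n \<omega>)) - integral\<^sup>L M (\<lambda>\<omega>. f (X n \<omega>)) - 0) < r"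
      by (simp add: eventually_sequentially)
  qed
  moreover have "(\<lambda>n. integral\<^sup>L M (\<lambda>\<omega>. f (X n \<omega>))) \<longlonglongrightarrow> integral\<^sup>L \<mu> f"
    using X f unfolding conv_distr_def by blast
  ultimately show "(\<lambda>n. integral\<^sup>L M (\<lambda>\<omega>. f (Y n \<omega>))) \<longlonglongrightarrow> integral\<^sup>L \<mu> f"
    by (rule Lim_transform[rotated])
qed

lemma conv_distr_continuous_map:
  fixes g :: "'b::euclidean_space \<Rightarrow> 'c::euclidean_space"
  assumes X: "conv_distr M X \<mu>" and sets[measurable_cong]: "sets \<mu> = sets borel" and g: "continuous_on UNIV g"
  shows "conv_distr M (\<lambda>n \<omega>. g (X n \<omega>)) (distr \<mu> borel g)"
  unfolding conv_distr_def
proof (intro conjI allI impI)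
  have [measurable]: "g \<in> borel_measurable borel" using g by (rule borel_measurable_continuous_onI)
  have [measurable]: "X n \<in> borel_measurable M" for n using X by (simp add: conv_distr_def)
  show "(\<lambda>\<omega>. g (X n \<omega>)) \<in> borel_measurable M" for n by measurable
  fix f :: "'c \<Rightarrow> real" assume f: "continuous_on UNIV f \<and> bounded (range f)"
  then have [measurable]: "f \<in> borel_measurable borel" by (intro borel_measurable_continuous_onI) simp
  have "continuous_on UNIV (\<lambda>x. f (g x))"
    using f g by (auto intro: continuous_on_compose2)
  moreover have "bounded (range (\<lambda>x. f (g x)))" using f by (auto simp: bounded_iff)
  ultimately have "(\<lambda>n. integral\<^sup>L M (\<lambda>\<omega>. f (g (X n \<omega>)))) \<longlonglongrightarrow> integral\<^sup>L \<mu> (\<lambda>x. f (g x))"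
    using X unfolding conv_distr_def by blast
  also have "integral\<^sup>L \<mu> (\<lambda>x. f (g x)) = integral\<^sup>L (distr \<mu> borel g) f"
    by (subst integral_distr) auto
  finally show "(\<lambda>n. integral\<^sup>L M (\<lambda>\<omega>. f (g (X n \<omega>)))) \<longlonglongrightarrow> integral\<^sup>L (distr \<mu> borel g) f" .
qed

subsection \<open>Asymptotic normality of the approximate maximizer\<close>

text \<open>Passing from \<open>q0\<close> to \<open>q\<close> to \<open>qt\<close> at
  \<open>x\<close>, and back at \<open>y\<close>, costs \<open>e / 4\<close> four times, with the
  maximality of \<open>y\<close> in between.\<close>

lemma argmax_near_limit:
  fixes q qt q0 :: "'a::metric_space \<Rightarrow> real"
  assumes sep: "\<forall>y\<in>K. q0 x - e \<le> q0 y \<longrightarrow> dist x y < d"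
    and x: "x \<in> K" and y: "y \<in> K" "\<And>z. z \<in> K \<Longrightarrow> qt z \<le> qt y"
    and q: "\<forall>z\<in>K. \<bar>q z - q0 z\<bar> \<le> e / 4" and qt: "\<forall>z\<in>K. \<bar>qt z - q z\<bar> \<le> e / 4"
  shows "dist x y < d"
proof -
  have "q0 x - e \<le> q0 y"
    using q[rule_format, OF x] q[rule_format, OF y(1)] qt[rule_format, OF x] qt[rule_format, OF y(1)] y(2)[OF x]
    by linarith
  with sep y(1) show ?thesis by blast
qed

text \<open>The deterministic core, for one sample point: \<open>x\<close> is the true parameter,
  \<open>y\<close> the estimator, \<open>r\<close> the rate and \<open>B\<close> the inverse of the
  limiting Hessian \<open>A\<close>. A crude bound on the scaled error comes first and is then fed
  back into the remainder.\<close>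

lemma estimator_expansion:
  fixes q qt :: "real^'p \<Rightarrow> real" and x y :: "real^'p" and A B :: "real^'p^'p"
  assumes S: "convex S" "x \<in> S" "y \<in> S"
    and q: "\<And>z. z \<in> S \<Longrightarrow> grad q differentiable (at z)"
    and hess: "\<And>z. z \<in> S \<Longrightarrow> norm (hess q z - A) \<le> \<eta>"
    and inv: "B ** A = mat 1" and B: "\<And>v. norm (B *v v) \<le> c * norm v"
    and c: "0 < c" and \<eta>: "0 \<le> \<eta>" "c * \<eta> \<le> 1 / 2" and r: "0 \<le> r"
    and score: "norm (r *\<^sub>R grad q x) \<le> R"
    and qt: "grad qt y = 0" and close: "r * norm (grad qt y - grad q y) \<le> e"
  shows "norm (r *\<^sub>R (y - x) - (- B) *v (r *\<^sub>R grad q x)) \<le> c * (e + \<eta> * (2 * c * (e + R)))"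
proof -
  define w where "w = grad q y - grad q x - A *v (y - x)"
  have w: "norm w \<le> \<eta> * norm (y - x)"
    unfolding w_def using S q hess by (rule grad_linearization)
  have BA: "B *v (A *v v) = v" for v by (simp add: matrix_vector_mul_assoc inv)
  have minus: "(- B) *v v = - (B *v v)" for v
    by (simp add: vec_eq_iff matrix_vector_mult_def sum_negf)
  define m where "m = r * norm (y - x)"
  have rw: "norm (r *\<^sub>R w) \<le> \<eta> * m"
    using mult_left_mono[OF w r] r by (simp add: m_def mult_ac)
  have ry: "norm (r *\<^sub>R grad q y) \<le> e" using close qt r by simp
  have "r *\<^sub>R (A *v (y - x)) = r *\<^sub>R grad q y - r *\<^sub>R grad q x - r *\<^sub>R w"
    by (simp add: w_def algebra_simps)
  then have *: "r *\<^sub>R (y - x) = B *v (r *\<^sub>R grad q y - r *\<^sub>R grad q x - r *\<^sub>R w)"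
    by (metis BA matrix_vector_mult_scaleR)
  \<comment> \<open>The error \<open>m\<close> is bounded in terms of itself;
    \<open>c * \<eta> \<le> 1 / 2\<close> lets half of it be absorbed on the left.\<close>
  have "m = norm (B *v (r *\<^sub>R grad q y - r *\<^sub>R grad q x - r *\<^sub>R w))"
    using r by (simp add: m_def flip: *)
  also have "\<dots> \<le> c * norm (r *\<^sub>R grad q y - r *\<^sub>R grad q x - r *\<^sub>R w)" by (rule B)
  also have "\<dots> \<le> c * (e + R + \<eta> * m)"
    using c rw ry score norm_triangle_ineq4[of "r *\<^sub>R grad q y - r *\<^sub>R grad q x" "r *\<^sub>R w"]
      norm_triangle_ineq4[of "r *\<^sub>R grad q y" "r *\<^sub>R grad q x"]
    by (intro mult_left_mono) auto
  also have "\<dots> = c * (e + R) + (c * \<eta>) * m" by (simp add: algebra_simps)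
  also have "(c * \<eta>) * m \<le> (1 / 2) * m"
    using \<eta>(2) r by (intro mult_right_mono) (simp_all add: m_def)
  finally have m: "m \<le> 2 * c * (e + R)" by simp
  \<comment> \<open>The score cancels, so only the residual gradient at \<open>y\<close> and the
    linearization error remain.\<close>
  have "r *\<^sub>R (y - x) - (- B) *v (r *\<^sub>R grad q x) = B *v (r *\<^sub>R grad q y - r *\<^sub>R w)"
    unfolding * minus by (simp add: matrix_vector_mult_diff_distrib)
  then have "norm (r *\<^sub>R (y - x) - (- B) *v (r *\<^sub>R grad q x)) \<le> c * norm (r *\<^sub>R grad q y - r *\<^sub>R w)"
    using B by metis
  also have "\<dots> \<le> c * (e + \<eta> * m)"
    using c rw ry norm_triangle_ineq4[of "r *\<^sub>R grad q y" "r *\<^sub>R w"] by (intro mult_left_mono) auto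
  also have "\<dots> \<le> c * (e + \<eta> * (2 * c * (e + R)))"
    using c \<eta> m by (simp add: mult_left_mono)
  finally show ?thesis .
qed

text \<open>The conclusion is deterministic, so for each \<open>\<epsilon>\<close> a single sample
  point whose Hessian at \<open>x\<close> is within \<open>\<epsilon>\<close> of the limit is
  enough. It exists because the exceptional event has probability below 1.\<close>

lemma symmetric_limit_hess:
  fixes Q :: "nat \<Rightarrow> 'a \<Rightarrow> real^'p \<Rightarrow> real"
  assumes M: "prob_space M" and N: "open N" "x \<in> N"
    and C2: "\<And>n \<omega>. \<omega> \<in> space M \<Longrightarrow> C2_on (Q n \<omega>) N"
    and hess: "unif_plim0 M (\<lambda>n \<omega> \<theta>. norm (hess (Q n \<omega>) \<theta> - H \<theta>)) N"
  shows "transpose (H x) = H x"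
proof -
  interpret prob_space M by fact
  have le: "\<bar>H x $ i $ j - H x $ j $ i\<bar> \<le> 2 * \<epsilon>" if \<epsilon>: "\<epsilon> > 0" for i j \<epsilon>
  proof -
    have "eventually_prob M 1 (\<lambda>n \<omega>. \<forall>\<theta>\<in>N. norm (hess (Q n \<omega>) \<theta> - H \<theta>) \<le> \<epsilon>)"
      using hess \<epsilon> zero_less_one by (rule eventually_prob_unif_plim0)
    then obtain n E where E: "E \<in> sets M" "prob E < 1"
      "\<And>\<omega>. \<omega> \<in> space M - E \<Longrightarrow> \<forall>\<theta>\<in>N. norm (hess (Q n \<omega>) \<theta> - H \<theta>) \<le> \<epsilon>"
      unfolding eventually_prob_def by (auto dest!: eventually_happens)
    have "space M - E \<noteq> {}"
      using E(1,2) prob_space sets.sets_into_space by (metis Diff_eq_empty_iff less_irrefl subset_antisym)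
    then obtain \<omega> where \<omega>: "\<omega> \<in> space M" "\<omega> \<in> space M - E" by blast
    define D where "D = hess (Q n \<omega>) x"
    have "norm (D - H x) \<le> \<epsilon>" using E(3)[OF \<omega>(2)] N(2) by (simp add: D_def)
    then have ent: "\<bar>D $ i $ j - H x $ i $ j\<bar> \<le> \<epsilon>" for i j
      using component_le_norm_cart[of "(D - H x) $ i" j] Finite_Cartesian_Product.norm_nth_le[of "D - H x" i] by simp
    have "transpose D = D"
      unfolding D_def using C2[OF \<omega>(1), of n] N by (intro transpose_hess) (auto simp: C2_on_def)
    then have "D $ i $ j = D $ j $ i" by (metis transpose_def vec_lambda_beta)
    with ent[of i j] ent[of j i] show ?thesis by linarith
  qed
  have "H x $ i $ j = H x $ j $ i" for i j
  proof (rule ccontr)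
    assume "H x $ i $ j \<noteq> H x $ j $ i"
    then show False using le[of "\<bar>H x $ i $ j - H x $ j $ i\<bar> / 4" i j] by simp
  qed
  then show ?thesis by (simp add: vec_eq_iff transpose_def)
qed

theorem theorem4:
  fixes M :: "'a measure"
    and \<Theta> N :: "(real^'p) set"
    and Q Qt :: "nat \<Rightarrow> 'a \<Rightarrow> real^'p \<Rightarrow> real"
    and thetahat :: "nat \<Rightarrow> 'a \<Rightarrow> real^'p"
    and Q0 :: "real^'p \<Rightarrow> real"
    and theta0 :: "real^'p"
    and Sigma :: "real^'p^'p"
    and H :: "real^'p \<Rightarrow> real^'p^'p"
  assumes prob: "prob_space M"
    and argmax: "\<And>n \<omega>. \<omega> \<in> space M \<Longrightarrow> thetahat n \<omega> \<in> \<Theta> \<and>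
                     (\<forall>\<theta>\<in>\<Theta>. Qt n \<omega> \<theta> \<le> Qt n \<omega> (thetahat n \<omega>))"
    and thetahat_meas: "\<And>n. thetahat n \<in> borel_measurable M"
    and Sigma_psd: "transpose Sigma = Sigma" "\<And>x. 0 \<le> x \<bullet> (Sigma *v x)"
    (* (i) *)
    and theta0_in: "theta0 \<in> \<Theta>"
    and unique_max: "\<And>\<theta>. \<theta> \<in> \<Theta> \<Longrightarrow> \<theta> \<noteq> theta0 \<Longrightarrow> Q0 \<theta> < Q0 theta0"
    and compact: "compact \<Theta>"
    and Q0_cont: "continuous_on \<Theta> Q0"
    and Q_unif: "unif_plim0 M (\<lambda>n \<omega> \<theta>. \<bar>Q n \<omega> \<theta> - Q0 \<theta>\<bar>) \<Theta>"
    and interior: "theta0 \<in> interior \<Theta>"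
    and N_nbhd: "open N" "theta0 \<in> N"
    and Q_C2: "\<And>n \<omega>. \<omega> \<in> space M \<Longrightarrow> C2_on (Q n \<omega>) N"
    and score_clt: "conv_distr M (\<lambda>n \<omega>. sqrt (real n) *\<^sub>R grad (Q n \<omega>) theta0) (mvn0 Sigma)"
    and H_cont: "isCont H theta0"
    and hess_unif: "unif_plim0 M (\<lambda>n \<omega> \<theta>. norm (hess (Q n \<omega>) \<theta> - H \<theta>)) N"
    and H_nonsing: "invertible (H theta0)"
    (* (ii) *)
    and Qt_C2: "\<And>n. AE \<omega> in M. C2_on (Qt n \<omega>) N"
    (* (iii) *)
    and approx_val: "unif_plim0 M (\<lambda>n \<omega> \<theta>. \<bar>Qt n \<omega> \<theta> - Q n \<omega> \<theta>\<bar>) \<Theta>"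
    (* (iv) *)
    and approx_grad: "unif_plim0 M (\<lambda>n \<omega> \<theta>. sqrt (real n) * norm (grad (Qt n \<omega>) \<theta> - grad (Q n \<omega>) \<theta>)) \<Theta>"
    (* (v) *)
    and approx_hess: "unif_plim0 M (\<lambda>n \<omega> \<theta>. norm (hess (Qt n \<omega>) \<theta> - hess (Q n \<omega>) \<theta>)) \<Theta>"
  shows "conv_distr M (\<lambda>n \<omega>. sqrt (real n) *\<^sub>R (thetahat n \<omega> - theta0))
           (mvn0 (matrix_inv (H theta0) ** Sigma ** matrix_inv (H theta0)))"
proof -
  interpret prob_space M by fact

  \<comment> \<open>Inverse of the limiting Hessian\<close>
  define A where "A = H theta0"
  define B where "B = matrix_inv A"
  have A: "transpose A = A"
    unfolding A_def using prob N_nbhd Q_C2 hess_unif by (rule symmetric_limit_hess)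
  have BA: "B ** A = mat 1" and AB: "A ** B = mat 1"
    using H_nonsing unfolding A_def[symmetric] B_def invertible_def matrix_inv_def by (metis (mono_tags, lifting) someI)+
  \<comment> \<open>Symmetry passes to the inverse; it turns the covariance
    \<open>B ** Sigma ** transpose B\<close> of the linear image into the one claimed.\<close>
  have "transpose B = transpose B ** (A ** B)" by (simp add: AB)
  also have "\<dots> = transpose (A ** B) ** B" by (simp add: matrix_transpose_mul A matrix_mul_assoc)
  also have "\<dots> = B" by (simp add: AB transpose_mat)
  finally have B: "transpose B = B" .

  \<comment> \<open>Limit law of the linearized estimator\<close>
  define S where "S n \<omega> = sqrt (real n) *\<^sub>R grad (Q n \<omega>) theta0" for n \<omega>
  have S: "conv_distr M S (mvn0 Sigma)" using score_clt by (simp add: S_def[abs_def])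
  have lim: "conv_distr M (\<lambda>n \<omega>. (- B) *v S n \<omega>) (mvn0 (B ** Sigma ** B))"
  proof -
    \<comment> \<open>The sign enters the covariance twice and cancels.\<close>
    have "(- B) ** Sigma ** transpose (- B) = B ** Sigma ** B"
    proof -
      have "transpose (- B) = - B" using B by (simp add: vec_eq_iff transpose_def)
      then show ?thesis
        by (simp add: vec_eq_iff matrix_matrix_mult_def sum_negf)
    qed
    then have "distr (mvn0 Sigma) borel ((*v) (- B)) = mvn0 (B ** Sigma ** B)"
      using mvn0_distr_matrix[OF Sigma_psd, of "- B"] by simp
    moreover have "continuous_on UNIV ((*v) (- B))" by (simp add: linear_continuous_on)
    ultimately show ?thesis using conv_distr_continuous_map[OF S, of "(*v) (- B)"] by simp
  qed

  \<comment> \<open>Comparison of the estimator with its linearization\<close>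
  define c where "c = norm B + 1"
  have c: "c > 0" by (simp add: c_def add_nonneg_pos)
  have Bc: "norm (B *v v) \<le> c * norm v" for v
    using norm_matrix_vector_le[of B v] by (simp add: c_def distrib_right) (smt (verit) norm_ge_zero)

  have "conv_distr M (\<lambda>n \<omega>. sqrt (real n) *\<^sub>R (thetahat n \<omega> - theta0)) (mvn0 (B ** Sigma ** B))"
  proof (rule conv_distr_Slutsky[OF prob lim])
    show "sets (mvn0 (B ** Sigma ** B)) = sets borel" by simp
    show "(\<lambda>\<omega>. sqrt (real n) *\<^sub>R (thetahat n \<omega> - theta0)) \<in> borel_measurable M" for n
      using thetahat_meas[of n] by measurable
    fix \<epsilon> e :: real assume \<epsilon>: "0 < \<epsilon>" and e: "0 < e"
    \<comment> \<open>Six exceptional events are united below, each of probability less than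
      \<open>p\<close>.\<close>
    define p where "p = e / 6"
    have p: "p > 0" using e by (simp add: p_def)
    obtain R where R: "R \<ge> 0" and tight: "eventually_prob M p (\<lambda>n \<omega>. norm (S n \<omega>) \<le> R)"
      using conv_distr_tight[OF prob S sets_mvn0 p] by blast
    \<comment> \<open>\<open>g\<close> bounds the scaled gradient discrepancy and
      \<open>\<eta>\<close> the Hessian error. The first bound on \<open>\<eta>\<close> permits the
      absorption in \<open>estimator_expansion\<close>; the others make its two error terms at most
      \<open>\<epsilon> / 2\<close> each, with \<open>g \<le> 1\<close> replacing
      \<open>g + R\<close> by \<open>1 + R\<close>.\<close>
    define g where "g = min 1 (\<epsilon> / (2 * c))"
    define \<eta> where "\<eta> = min (1 / (2 * c)) (\<epsilon> / (4 * c\<^sup>2 * (1 + R)))"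
    have g: "g > 0" "g \<le> 1" "c * g \<le> \<epsilon> / 2"
      using c \<epsilon> by (auto simp: g_def min_def field_simps)
    have "\<epsilon> / (4 * c\<^sup>2 * (1 + R)) > 0" using c \<epsilon> R by (intro divide_pos_pos mult_pos_pos) auto
    then have \<eta>: "\<eta> > 0" "c * \<eta> \<le> 1 / 2" and \<eta>': "\<eta> \<le> \<epsilon> / (4 * c\<^sup>2 * (1 + R))"
      using c mult_left_mono[of \<eta> "1 / (2 * c)" c] by (simp_all add: \<eta>_def)
    have bound: "c * (g + \<eta> * (2 * c * (g + R))) \<le> \<epsilon>"
    proof -
      have "c * (\<eta> * (2 * c * (g + R))) \<le> c * (\<epsilon> / (4 * c\<^sup>2 * (1 + R)) * (2 * c * (1 + R)))"
        using c R \<eta> \<eta>' g \<epsilon> by (intro mult_left_mono mult_mono) auto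
      also have "\<dots> = \<epsilon> / 2" using c R by (simp add: power2_eq_square divide_simps)
      finally show ?thesis using g(3) by (simp add: distrib_left)
    qed
    \<comment> \<open>Half of \<open>\<eta>\<close> is spent on the continuity of \<open>H\<close>,
      the other half on the uniform convergence of the Hessians.\<close>
    obtain d1 where d1: "d1 > 0" "\<And>z. dist z theta0 < d1 \<Longrightarrow> dist (H z) A < \<eta> / 2"
      using H_cont \<eta>(1) unfolding A_def continuous_at by (metis half_gt_zero continuous_at_eps_delta continuous_at)
    \<comment> \<open>Inside \<open>N\<close> the objectives are smooth, and in the interior of
      \<open>\<Theta>\<close> a maximizer is a critical point. A ball is also convex, as the
      linearization requires.\<close>
    obtain d2 where d2: "d2 > 0" "ball theta0 d2 \<subseteq> N \<inter> interior \<Theta>"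
      using N_nbhd interior open_interior[of \<Theta>] by (metis Int_iff open_Int openE)
    define d where "d = min d1 d2"
    have d: "d > 0" using d1 d2 by (simp add: d_def)
    have ball: "z \<in> N" "z \<in> interior \<Theta>" "norm (H z - A) \<le> \<eta> / 2" if "z \<in> ball theta0 d" for z
      using that d1(2)[of z] d2(2) norm_minus_commute[of "H z" A] by (auto simp: d_def dist_commute dist_norm)
    obtain b where b: "b > 0" "\<forall>y\<in>\<Theta>. Q0 theta0 - b \<le> Q0 y \<longrightarrow> dist theta0 y < d"
      using well_separated_max[OF compact Q0_cont unique_max d] by blast
    have b4: "b / 4 > 0" using b by simp
    note conj = eventually_prob_conj[OF finite_measure_axioms]
    have "eventually_prob M (p + (p + (p + (p + (p + p))))) (\<lambda>n \<omega>. norm (S n \<omega>) \<le> R \<and>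
        (\<forall>\<theta>\<in>\<Theta>. \<bar>Q n \<omega> \<theta> - Q0 \<theta>\<bar> \<le> b / 4) \<and> (\<forall>\<theta>\<in>\<Theta>. \<bar>Qt n \<omega> \<theta> - Q n \<omega> \<theta>\<bar> \<le> b / 4) \<and>
        (\<forall>\<theta>\<in>\<Theta>. sqrt (real n) * norm (grad (Qt n \<omega>) \<theta> - grad (Q n \<omega>) \<theta>) \<le> g) \<and>
        (\<forall>\<theta>\<in>N. norm (hess (Q n \<omega>) \<theta> - H \<theta>) \<le> \<eta> / 2) \<and> C2_on (Qt n \<omega>) N)"
      using \<eta>(1) by (intro conj tight eventually_prob_AE Qt_C2 p
          eventually_prob_unif_plim0[OF Q_unif b4] eventually_prob_unif_plim0[OF approx_val b4]
          eventually_prob_unif_plim0[OF approx_grad g(1)] eventually_prob_unif_plim0[OF hess_unif]) simp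
    moreover have "p + (p + (p + (p + (p + p)))) = e" by (simp add: p_def)
    ultimately have "eventually_prob M e (\<lambda>n \<omega>. norm (S n \<omega>) \<le> R \<and>
        (\<forall>\<theta>\<in>\<Theta>. \<bar>Q n \<omega> \<theta> - Q0 \<theta>\<bar> \<le> b / 4) \<and> (\<forall>\<theta>\<in>\<Theta>. \<bar>Qt n \<omega> \<theta> - Q n \<omega> \<theta>\<bar> \<le> b / 4) \<and>
        (\<forall>\<theta>\<in>\<Theta>. sqrt (real n) * norm (grad (Qt n \<omega>) \<theta> - grad (Q n \<omega>) \<theta>) \<le> g) \<and>
        (\<forall>\<theta>\<in>N. norm (hess (Q n \<omega>) \<theta> - H \<theta>) \<le> \<eta> / 2) \<and> C2_on (Qt n \<omega>) N)" by simp
    then show "eventually_prob M e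
        (\<lambda>n \<omega>. norm (sqrt (real n) *\<^sub>R (thetahat n \<omega> - theta0) - (- B) *v S n \<omega>) \<le> \<epsilon>)"
    proof (rule eventually_prob_mono, elim conjE)
      fix n \<omega>
      assume \<omega>: "\<omega> \<in> space M" and score: "norm (S n \<omega>) \<le> R"
        and q: "\<forall>\<theta>\<in>\<Theta>. \<bar>Q n \<omega> \<theta> - Q0 \<theta>\<bar> \<le> b / 4" and qt: "\<forall>\<theta>\<in>\<Theta>. \<bar>Qt n \<omega> \<theta> - Q n \<omega> \<theta>\<bar> \<le> b / 4"
        and grd: "\<forall>\<theta>\<in>\<Theta>. sqrt (real n) * norm (grad (Qt n \<omega>) \<theta> - grad (Q n \<omega>) \<theta>) \<le> g"
        and hss: "\<forall>\<theta>\<in>N. norm (hess (Q n \<omega>) \<theta> - H \<theta>) \<le> \<eta> / 2" and C2: "C2_on (Qt n \<omega>) N"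
      define y where "y = thetahat n \<omega>"
      have y: "y \<in> \<Theta>" "\<And>z. z \<in> \<Theta> \<Longrightarrow> Qt n \<omega> z \<le> Qt n \<omega> y"
        using argmax[OF \<omega>] by (auto simp: y_def)
      have yd: "y \<in> ball theta0 d"
        using argmax_near_limit[OF b(2) theta0_in y q qt] by simp
      have "grad (Qt n \<omega>) y = 0"
        using ball[OF yd] y C2 by (intro grad_eq_0_at_max) (auto simp: C2_on_def)
      moreover have "sqrt (real n) * norm (grad (Qt n \<omega>) y - grad (Q n \<omega>) y) \<le> g"
        using grd y by blast
      moreover have "norm (hess (Q n \<omega>) z - A) \<le> \<eta>" if "z \<in> ball theta0 d" for z
        using hss ball[OF that] norm_triangle_ineq[of "hess (Q n \<omega>) z - H z" "H z - A"] by force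
      moreover have "grad (Q n \<omega>) differentiable (at z)" if "z \<in> ball theta0 d" for z
        using Q_C2[OF \<omega>, of n] ball[OF that] by (auto simp: C2_on_def)
      ultimately have "norm (sqrt (real n) *\<^sub>R (y - theta0) - (- B) *v (sqrt (real n) *\<^sub>R grad (Q n \<omega>) theta0))
          \<le> c * (g + \<eta> * (2 * c * (g + R)))"
        using yd d c \<eta> score BA Bc
        by (intro estimator_expansion[where S="ball theta0 d" and A=A and qt="Qt n \<omega>"]) (auto simp: S_def)
      then show "norm (sqrt (real n) *\<^sub>R (thetahat n \<omega> - theta0) - (- B) *v S n \<omega>) \<le> \<epsilon>"
        using bound by (simp add: S_def y_def)
    qed
  qed
  then show ?thesis by (simp add: B_def A_def)
qed

end
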